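(* Let $\gamma>1$ and let $f:(0,\infty)\to\mathbb R$ be continuously differentiable with $f'(t)=t^{\gamma-1+o(1)}$ as $t\to\infty$, i.e. for every $\varepsilon>0$ one has $t^{\gamma-1-\varepsilon}\leqslant f'(t)\leqslant t^{\gamma-1+\varepsilon}$ for all sufficiently large $t$. Then for any sequence of complex numbers $\mathbf a=(a_n)_{n=1}^\infty$ with $|a_n|=1$ there is a constant $c>0$ (which may depend on $f$) such that for any interval $\mathfrak I\subseteq\mathbb R$ the set of $x\in\mathfrak I$ satisfying $$\Big|\sum_{1\leqslant n\leqslant N} a_n\,\mathbf e(xf(n))\Big|\geqslant cN^{1/2}\quad\text{for infinitely many } N\in\mathbb N$$ has Hausdorff dimension at least $1-1/\gamma$.
   Context: $\mathbf e(x)=\exp(2\pi i x)$. *)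

theory Defs
  imports "HOL-Analysis.Analysis"
begin

definition e :: "real \<Rightarrow> complex" where
  "e x = exp (2 * complex_of_real pi * \<i> * complex_of_real x)"

text \<open>
  The contribution \<open>(diam U)\<^sup>s\<close> of a bounded set to a cover. Two conventions have to be
  imposed by hand: the empty set contributes 0, and \<open>0\<^sup>0 = 1\<close> (whereas \<open>0 powr 0 = 0\<close>), so that
  the 0-dimensional measure is counting measure.
\<close>
definition diam_power :: "real \<Rightarrow> 'a::metric_space set \<Rightarrow> ennreal" where
  "diam_power s U =
     (if U = {} then 0 else if s = 0 then 1 else ennreal (diameter U powr s))"

text \<open>
  The covering sets must be explicitly bounded, since \<^const>\<open>diameter\<close> is a real number and
  is unspecified on unbounded sets. Finite covers are included because the sets may be empty.
\<close>
definition hausdorff_premeasure :: "real \<Rightarrow> real \<Rightarrow> 'a::metric_space set \<Rightarrow> ennreal" where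
  "hausdorff_premeasure s \<delta> A =
     (INF U \<in> {U :: nat \<Rightarrow> 'a set.
         A \<subseteq> (\<Union>i. U i) \<and> (\<forall>i. bounded (U i) \<and> diameter (U i) \<le> \<delta>)}.
       \<Sum>i. diam_power s (U i))"

definition hausdorff_measure :: "real \<Rightarrow> 'a::metric_space set \<Rightarrow> ennreal" where
  "hausdorff_measure s A = (SUP \<delta>\<in>{0<..}. hausdorff_premeasure s \<delta> A)"

definition hausdorff_dim :: "'a::metric_space set \<Rightarrow> ennreal" where
  "hausdorff_dim A = Inf {ennreal s | s. 0 \<le> s \<and> hausdorff_measure s A = 0}"

end

theory Submission
  imports Defs
begin

text \<open>
  Let \<open>D\<close> be the block of the sum over \<open>N < n \<le> 2N\<close>. The gaps between the frequencies \<open>f n\<close> are at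
  least \<open>N\<^sup>\<gamma>\<^sup>-\<^sup>1\<^sup>-\<^sup>\<epsilon>\<close>, so on every interval slightly longer than \<open>N\<^sup>1\<^sup>-\<^sup>\<gamma>\<close> the off-diagonal terms
  in the mean squares of \<open>D\<close> and of its derivative are negligible: these mean squares are about \<open>N\<close>
  and at most about \<open>N\<close> times the square of the spread \<open>N\<^sup>\<gamma>\<^sup>+\<^sup>\<epsilon>\<close> of the frequencies. Comparing the two, every such
  interval contains an interval of length about \<open>N\<^sup>-\<^sup>\<gamma>\<close> on all of which \<open>D\<close> has size at least
  \<open>sqrt N / 4\<close>, so that the partial sum up to \<open>N\<close> or the one up to \<open>2N\<close> is large.

  Hence the exceptional set contains a limsup set of intervals of length about \<open>N\<^sup>-\<^sup>\<gamma>\<close>, one in every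
  interval of length about \<open>N\<^sup>1\<^sup>-\<^sup>\<gamma>\<close>. Given a cover of it with \<open>s\<close>-dimensional weight too small for
  some \<open>s < (\<gamma> - 1) / \<gamma>\<close>, averaging produces nested intervals \<open>J\<close> such that the sets of the cover
  meeting \<open>J\<close> have total weight less than a constant times \<open>(diam J)\<^sup>s\<close>. Their common point lies in
  the limsup set, but in no set of the cover.
\<close>

subsection \<open>Mean squares of exponential sums\<close>

lemma e_eq_cis: "e x = cis (2 * pi * x)"
  by (simp add: e_def cis_conv_exp mult_ac)

lemma norm_e [simp]: "norm (e x) = 1"
  by (simp add: e_eq_cis)

lemma e_add: "e (x + y) = e x * e y"
  by (simp add: e_eq_cis cis_mult distrib_left)

lemma cnj_e: "cnj (e x) = e (- x)"
  by (simp add: e_eq_cis cis_cnj)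

lemma e_0 [simp]: "e 0 = 1"
  by (simp add: e_def)

lemma has_vector_derivative_e:
  "((\<lambda>x. e (x * l)) has_vector_derivative (2 * pi * l) * \<i> * e (x * l)) (at x within S)"
proof -
  have "((\<lambda>z. exp (2 * pi * \<i> * (z * l))) has_field_derivative
      (2 * pi * l) * \<i> * exp (2 * pi * \<i> * (of_real x * l))) (at (of_real x))"
    by (auto intro!: derivative_eq_intros)
  from has_vector_derivative_real_field[OF this] show ?thesis
    by (simp add: e_def)
qed

lemma continuous_on_e [continuous_intros]:
  assumes "continuous_on S g"
  shows "continuous_on S (\<lambda>x. e (g x))"
  unfolding e_def using assms by (intro continuous_intros)

text \<open>The antiderivative \<open>e (x * l) / (2 * pi * l * \<i>)\<close> has constant norm, so
  its two end values give at most \<open>1 / (pi * \<bar>l\<bar>)\<close>, uniformly in the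
  interval.\<close>

lemma norm_integral_e_le:
  assumes "l \<noteq> 0" "u \<le> v"
  shows "norm (integral {u..v} (\<lambda>x. e (x * l))) \<le> 1 / \<bar>l\<bar>"
proof -
  let ?c = "(2 * pi * l) * \<i> :: complex"
  have c: "?c \<noteq> 0"
    using assms by simp
  have "((\<lambda>x. e (x * l)) has_integral e (v * l) / ?c - e (u * l) / ?c) {u..v}"
  proof (rule fundamental_theorem_of_calculus[OF assms(2)])
    fix x assume "x \<in> {u..v}"
    have "((\<lambda>x. e (x * l) / ?c) has_vector_derivative ?c * e (x * l) / ?c) (at x within {u..v})"
      by (intro has_vector_derivative_divide has_vector_derivative_e)
    then show "((\<lambda>x. e (x * l) / ?c) has_vector_derivative e (x * l)) (at x within {u..v})"
      using c by simp
  qed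
  then have "norm (integral {u..v} (\<lambda>x. e (x * l))) = norm (e (v * l) - e (u * l)) / norm ?c"
    by (simp add: integral_unique diff_divide_distrib[symmetric] norm_divide)
  also have "\<dots> \<le> 2 / norm ?c"
    by (intro divide_right_mono order_trans[OF norm_triangle_ineq4]) auto
  also have "\<dots> = 1 / (pi * \<bar>l\<bar>)"
    by (simp add: norm_mult)
  also have "\<dots> \<le> 1 / \<bar>l\<bar>"
    using assms pi_ge_two by (intro divide_left_mono) (auto intro: mult_le_cancel_right1[THEN iffD2])
  finally show ?thesis .
qed

text \<open>On each side of \<open>n\<close> the distances to \<open>n\<close> are distinct integers
  in \<open>{1..L}\<close>, so each side contributes at most one harmonic sum.\<close>

lemma sum_inverse_distance_le_harm:
  fixes n M L :: nat
  assumes n: "n \<in> {M<..M+L}"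
  shows "(\<Sum>m\<in>{M<..M+L} - {n}. 1 / \<bar>real m - real n\<bar>) \<le> 2 * harm L"
proof -
  have below: "(\<Sum>m\<in>{M<..<n}. 1 / \<bar>real m - real n\<bar>) \<le> harm L"
  proof -
    have "(\<Sum>m\<in>{M<..<n}. 1 / \<bar>real m - real n\<bar>) = (\<Sum>m\<in>{M<..<n}. inverse (real (n - m)))"
      by (intro sum.cong) (auto simp: of_nat_diff inverse_eq_divide)
    also have "\<dots> = (\<Sum>k\<in>(\<lambda>m. n - m) ` {M<..<n}. inverse (real k))"
      by (subst sum.reindex) (auto simp: inj_on_def)
    also have "\<dots> \<le> (\<Sum>k\<in>{1..L}. inverse (real k))"
      using n by (intro sum_mono2) auto
    finally show ?thesis by (simp add: harm_def)
  qed
  have above: "(\<Sum>m\<in>{n<..M+L}. 1 / \<bar>real m - real n\<bar>) \<le> harm L"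
  proof -
    have "(\<Sum>m\<in>{n<..M+L}. 1 / \<bar>real m - real n\<bar>) = (\<Sum>m\<in>{n<..M+L}. inverse (real (m - n)))"
      by (intro sum.cong) (auto simp: of_nat_diff inverse_eq_divide)
    also have "\<dots> = (\<Sum>k\<in>(\<lambda>m. m - n) ` {n<..M+L}. inverse (real k))"
      by (subst sum.reindex) (auto simp: inj_on_def)
    also have "\<dots> \<le> (\<Sum>k\<in>{1..L}. inverse (real k))"
      using n by (intro sum_mono2) auto
    finally show ?thesis by (simp add: harm_def)
  qed
  have "{M<..M+L} - {n} = {M<..<n} \<union> {n<..M+L}"
    using n by auto
  moreover have disj: "{M<..<n} \<inter> {n<..M+L} = {}"
    by (auto simp only: set_eq_iff Int_iff greaterThanLessThan_iff greaterThanAtMost_iff empty_iff)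
  ultimately have "(\<Sum>m\<in>{M<..M+L} - {n}. 1 / \<bar>real m - real n\<bar>) =
      (\<Sum>m\<in>{M<..<n}. 1 / \<bar>real m - real n\<bar>) + (\<Sum>m\<in>{n<..M+L}. 1 / \<bar>real m - real n\<bar>)"
    by (metis sum.union_disjoint disj finite_greaterThanLessThan finite_greaterThanAtMost)
  then show ?thesis
    using below above by linarith
qed

text \<open>Expanding the square, the diagonal contributes the main term. The pair \<open>n\<close>,
  \<open>m\<close> off the diagonal has frequency at least
  \<open>\<delta> * \<bar>real m - real n\<bar>\<close>, so its integral is at most the reciprocal
  of this, and summing over \<open>m\<close> costs a harmonic number. The error does not grow with
  \<open>h\<close>, so the main term wins once \<open>h\<close> exceeds about
  \<open>harm L / \<delta>\<close>.\<close>

lemma mean_square_exponential_sum: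
  fixes \<nu> :: "nat \<Rightarrow> real" and b :: "nat \<Rightarrow> complex" and M L :: nat
  defines "A \<equiv> {M<..M+L}"
  assumes gap: "\<And>m n. m \<in> A \<Longrightarrow> n \<in> A \<Longrightarrow> \<bar>\<nu> m - \<nu> n\<bar> \<ge> \<delta> * \<bar>real m - real n\<bar>"
    and b: "\<And>n. n \<in> A \<Longrightarrow> norm (b n) \<le> B" and "\<delta> > 0" "h \<ge> 0"
  shows "\<bar>integral {u..u+h} (\<lambda>x. (norm (\<Sum>n\<in>A. b n * e (x * \<nu> n)))\<^sup>2) - h * (\<Sum>n\<in>A. (norm (b n))\<^sup>2)\<bar>
          \<le> B\<^sup>2 * (2 * L * harm L / \<delta>)"
proof -
  define c where "c = (\<lambda>n m. b n * cnj (b m))"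
  define I where "I = (\<lambda>l. integral {u..u+h} (\<lambda>x. e (x * l)))"
  have fin: "finite A" by (simp add: A_def)
  have "((\<lambda>x. \<Sum>n\<in>A. \<Sum>m\<in>A. c n m * e (x * (\<nu> n - \<nu> m))) has_integral
          (\<Sum>n\<in>A. \<Sum>m\<in>A. c n m * I (\<nu> n - \<nu> m))) {u..u+h}"
    unfolding I_def
    by (intro has_integral_sum fin has_integral_mult_right integrable_integral
          integrable_continuous_real continuous_intros)
  moreover have "(\<lambda>x. \<Sum>n\<in>A. \<Sum>m\<in>A. c n m * e (x * (\<nu> n - \<nu> m))) =
      (\<lambda>x. of_real ((norm (\<Sum>n\<in>A. b n * e (x * \<nu> n)))\<^sup>2))"
  proof
    fix x
    have "c n m * e (x * (\<nu> n - \<nu> m)) = (b n * e (x * \<nu> n)) * cnj (b m * e (x * \<nu> m))" for n m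
      using e_add[of "x * \<nu> n" "- (x * \<nu> m)"] by (simp add: c_def cnj_e right_diff_distrib)
    then show "(\<Sum>n\<in>A. \<Sum>m\<in>A. c n m * e (x * (\<nu> n - \<nu> m))) =
      of_real ((norm (\<Sum>n\<in>A. b n * e (x * \<nu> n)))\<^sup>2)"
      by (simp add: complex_norm_square sum_product del: of_real_power)
  qed
  ultimately have "((\<lambda>x. complex_of_real ((norm (\<Sum>n\<in>A. b n * e (x * \<nu> n)))\<^sup>2)) has_integral
          (\<Sum>n\<in>A. \<Sum>m\<in>A. c n m * I (\<nu> n - \<nu> m))) {u..u+h}"
    by simp
  from has_integral_linear[OF this bounded_linear_Re]
  have int: "integral {u..u+h} (\<lambda>x. (norm (\<Sum>n\<in>A. b n * e (x * \<nu> n)))\<^sup>2) =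
          Re (\<Sum>n\<in>A. \<Sum>m\<in>A. c n m * I (\<nu> n - \<nu> m))"
    by (intro integral_unique) (simp add: o_def)
  have I0: "I 0 = h"
    using \<open>h \<ge> 0\<close> by (simp add: I_def scaleR_conv_of_real)
  have "(\<Sum>m\<in>A. c n m * I (\<nu> n - \<nu> m)) = of_real (h * (norm (b n))\<^sup>2) +
      (\<Sum>m\<in>A - {n}. c n m * I (\<nu> n - \<nu> m))" if "n \<in> A" for n
    using sum.remove[OF fin that, of "\<lambda>m. c n m * I (\<nu> n - \<nu> m)"]
    by (simp add: I0 c_def complex_norm_square del: of_real_power)
  then have "(\<Sum>n\<in>A. \<Sum>m\<in>A. c n m * I (\<nu> n - \<nu> m)) =
     of_real (h * (\<Sum>n\<in>A. (norm (b n))\<^sup>2)) + (\<Sum>n\<in>A. \<Sum>m\<in>A - {n}. c n m * I (\<nu> n - \<nu> m))"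
    by (simp add: sum.distrib sum_distrib_left)
  then have "\<bar>integral {u..u+h} (\<lambda>x. (norm (\<Sum>n\<in>A. b n * e (x * \<nu> n)))\<^sup>2) - h * (\<Sum>n\<in>A. (norm (b n))\<^sup>2)\<bar>
      = \<bar>Re (\<Sum>n\<in>A. \<Sum>m\<in>A - {n}. c n m * I (\<nu> n - \<nu> m))\<bar>"
    by (simp only: int plus_complex.sel Re_complex_of_real add_diff_cancel_left')
  also have "\<dots> \<le> norm (\<Sum>n\<in>A. \<Sum>m\<in>A - {n}. c n m * I (\<nu> n - \<nu> m))"
    by (rule abs_Re_le_cmod)
  also have "\<dots> \<le> (\<Sum>n\<in>A. \<Sum>m\<in>A - {n}. B\<^sup>2 / \<delta> * (1 / \<bar>real m - real n\<bar>))"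
  proof (intro sum_norm_le)
    fix n m assume n: "n \<in> A" and m: "m \<in> A - {n}"
    have pos: "\<delta> * \<bar>real m - real n\<bar> > 0"
      using m \<open>\<delta> > 0\<close> by auto
    have l: "\<delta> * \<bar>real m - real n\<bar> \<le> \<bar>\<nu> n - \<nu> m\<bar>"
      using gap[of n m] m n by (simp add: abs_minus_commute)
    then have "norm (I (\<nu> n - \<nu> m)) \<le> 1 / \<bar>\<nu> n - \<nu> m\<bar>"
      unfolding I_def using pos \<open>h \<ge> 0\<close> by (intro norm_integral_e_le) auto
    also have "\<dots> \<le> 1 / (\<delta> * \<bar>real m - real n\<bar>)"
      using l pos by (intro frac_le) auto
    finally have "norm (I (\<nu> n - \<nu> m)) \<le> 1 / (\<delta> * \<bar>real m - real n\<bar>)" .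
    moreover have "norm (c n m) \<le> B * B"
      unfolding c_def norm_mult complex_mod_cnj
      using b[OF n] b[of m] m order_trans[OF norm_ge_zero b[OF n]] by (intro mult_mono) auto
    ultimately have "norm (c n m * I (\<nu> n - \<nu> m)) \<le> (B * B) * (1 / (\<delta> * \<bar>real m - real n\<bar>))"
      unfolding norm_mult by (intro mult_mono) auto
    then show "norm (c n m * I (\<nu> n - \<nu> m)) \<le> B\<^sup>2 / \<delta> * (1 / \<bar>real m - real n\<bar>)"
      by (simp add: power2_eq_square)
  qed
  also have "\<dots> \<le> (\<Sum>n\<in>A. B\<^sup>2 / \<delta> * (2 * harm L))"
  proof (intro sum_mono)
    fix n assume "n \<in> A"
    then show "(\<Sum>m\<in>A - {n}. B\<^sup>2 / \<delta> * (1 / \<bar>real m - real n\<bar>)) \<le> B\<^sup>2 / \<delta> * (2 * harm L)"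
      unfolding sum_distrib_left[symmetric] A_def
      using \<open>\<delta> > 0\<close> by (intro mult_left_mono sum_inverse_distance_le_harm) auto
  qed
  also have "\<dots> = B\<^sup>2 * (2 * L * harm L / \<delta>)"
    by (simp add: A_def)
  finally show ?thesis .
qed

subsection \<open>Hausdorff dimension of limsup sets\<close>

text \<open>The intervals lie in consecutive cells of length \<open>h\<close>. If \<open>p\<close>
  and \<open>q\<close> are the first and last index hit, \<open>U\<close> spans all cells strictly
  between them.\<close>

lemma card_indices_hit_le:
  fixes U :: "real set" and a b :: "nat \<Rightarrow> real"
  assumes "bounded U" "h > 0"
    and loc: "\<And>j. u + real j * h \<le> a j" "\<And>j. b j \<le> u + real (Suc j) * h"
  shows "real (card {j. j < m \<and> U \<inter> {a j..b j} \<noteq> {}}) \<le> 2 + diameter U / h"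
proof -
  define H where "H = {j. j < m \<and> U \<inter> {a j..b j} \<noteq> {}}"
  show ?thesis
  proof (cases "H = {}")
    case True
    then show ?thesis
      using assms diameter_ge_0[of U] unfolding H_def by (simp only: card.empty) simp
  next
    case False
    have fin: "finite H" by (simp add: H_def)
    define p q where "p = Min H" and "q = Max H"
    have pq: "p \<in> H" "q \<in> H" "p \<le> q"
      using fin False by (auto simp: p_def q_def)
    then obtain x y where x: "x \<in> U" "x \<le> b p" and y: "y \<in> U" "a q \<le> y"
      by (auto simp: H_def)
    have "y - x \<le> dist y x"
      by (simp add: dist_real_def)
    also have "\<dots> \<le> diameter U"
      using assms x y by (intro diameter_bounded_bound)
    \<comment> \<open>The \<open>- 1\<close> arises because \<open>x\<close> may lie at the right
      end of cell \<open>p\<close>, and \<open>y\<close> at the left end of cell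
      \<open>q\<close>.\<close>
    finally have "(real q - real p - 1) * h \<le> diameter U"
      using x y loc(1)[of q] loc(2)[of p] by (simp add: algebra_simps)
    then have "real q - real p - 1 \<le> diameter U / h"
      using \<open>h > 0\<close> by (simp add: field_simps)
    moreover have "card H \<le> card {p..q}"
      using fin by (intro card_mono) (auto simp: p_def q_def)
    ultimately show ?thesis
      using pq by (simp add: H_def)
  qed
qed

text \<open>The weights are a separate argument rather than powers of diameters, so that they can be
  enlarged to be strictly positive.\<close>

definition hit_weight :: "(nat \<Rightarrow> real set) \<Rightarrow> (nat \<Rightarrow> real) \<Rightarrow> real set \<Rightarrow> real" where
  "hit_weight U w S = (\<Sum>i. if U i \<inter> S \<noteq> {} then w i else 0)"

lemma summable_hits:
  fixes w :: "nat \<Rightarrow> real"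
  assumes "summable w" "\<And>i. w i \<ge> 0"
  shows "summable (\<lambda>i. if P i then w i else 0)"
  by (rule summable_comparison_test[OF _ assms(1)]) (use assms in auto)

lemma le_suminf_hits:
  fixes w :: "nat \<Rightarrow> real"
  assumes "summable w" "\<And>i. w i \<ge> 0" "P i"
  shows "w i \<le> (\<Sum>i. if P i then w i else 0)"
  using sum_le_suminf[OF summable_hits[OF assms(1,2)], of "{i}" P] assms by simp

text \<open>
  If every admissible \<open>J j\<close> had weight at least \<open>\<tau> = \<theta> * \<eta> powr s\<close>, then the sum over the sets
  \<open>U i\<close> meeting \<open>J j\<close> of \<open>min 1 (w i / \<tau>)\<close> would be at least 1 for every \<open>j\<close>. Summed over \<open>j\<close>, each
  \<open>U i\<close> is counted at most \<open>2 + diameter (U i) / h\<close> times; the bound \<open>w i / \<tau>\<close> is used for the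
  2 and the bound 1 for the other term. The truncation at 1 is what handles the large \<open>U i\<close>.
\<close>
lemma hit_weight_descent:
  fixes U :: "nat \<Rightarrow> real set" and w :: "nat \<Rightarrow> real" and G :: "real set"
  assumes U: "\<And>i. bounded (U i)" "\<And>i. diameter (U i) \<le> w i powr (1/s)"
    and w: "\<And>i. w i > 0" "summable w"
    and s: "0 < s" "s < 1" and h: "0 < h" "h \<le> l / 2" and \<eta>: "0 < \<eta>"
    and W: "hit_weight U w {u..u+l} < \<theta> * l powr s" and \<theta>: "\<theta> powr (1/s) \<le> 1/8" "\<theta> > 0"
    and small: "4 * l powr s * h \<le> l * \<eta> powr s / 4"
    and G: "\<And>u. \<exists>v\<ge>u. v + \<eta> \<le> u + h \<and> {v..v+\<eta>} \<subseteq> G"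
  shows "\<exists>v\<ge>u. v + \<eta> \<le> u + l \<and> {v..v+\<eta>} \<subseteq> G \<and> hit_weight U w {v..v+\<eta>} < \<theta> * \<eta> powr s"
proof (rule ccontr)
  assume no: "\<not> ?thesis"
  define m where "m = nat \<lfloor>l / h\<rfloor>"
  have l: "l > 0" using h by linarith
  have lh: "l / h \<ge> 2" using h by (simp add: field_simps)
  have m: "real m \<le> l / h" "real m \<ge> l / h - 1"
    using lh unfolding m_def by linarith+
  have m': "real m \<ge> l / (2 * h)"
    using m lh by simp
  \<comment> \<open>One candidate interval inside \<open>G\<close> is chosen in each of the
    consecutive cells of length \<open>h\<close>.\<close>
  obtain v where v: "\<And>j::nat. u + real j * h \<le> v j" "\<And>j. v j + \<eta> \<le> u + real j * h + h"
      "\<And>j. {v j..v j + \<eta>} \<subseteq> G"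
    using G[of "u + real _ * h"] by metis
  define J where "J = (\<lambda>j. {v j..v j + \<eta>})"
  define \<tau> where "\<tau> = \<theta> * \<eta> powr s"
  have \<tau>: "\<tau> > 0" using \<theta> \<eta> by (simp add: \<tau>_def)
  define c where "c = (\<lambda>i. min 1 (w i / \<tau>))"
  have c: "c i \<ge> 0" "c i \<le> 1" "c i \<le> w i / \<tau>" for i
    using w(1)[of i] \<tau> by (auto simp: c_def)
  have sum_c: "summable c"
    using summable_comparison_test[of c "\<lambda>i. w i / \<tau>"] c w by (auto intro: summable_divide)
  have J_sub: "J j \<subseteq> {u..u+l}" if "j < m" for j
  proof -
    have "real (Suc j) * h \<le> real m * h"
      using that h by (intro mult_right_mono) auto
    also have "\<dots> \<le> l"
      using m h by (simp add: field_simps)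
    finally have "real j * h + h \<le> l" by (simp add: algebra_simps)
    moreover have "real j * h \<ge> 0" using h by simp
    ultimately show ?thesis
      using v(1,2)[of j] unfolding J_def by (auto simp del: of_nat_Suc)
  qed
  have heavy: "hit_weight U w (J j) \<ge> \<tau>" if "j < m" for j
  proof -
    have "v j \<in> J j" "v j + \<eta> \<in> J j"
      using \<eta> by (auto simp: J_def)
    then have "u \<le> v j" "v j + \<eta> \<le> u + l"
      using J_sub[OF that] by auto
    then show ?thesis
      using no v(3)[of j] by (auto simp: J_def \<tau>_def not_less)
  qed
  \<comment> \<open>If the sum were below 1, then so would be each \<open>c i\<close> in it. Thus no
    truncation occurs, the weight of \<open>J j\<close> is \<open>\<tau>\<close> times the sum, and
    this is below \<open>\<tau>\<close>.\<close>
  have ge1: "(\<Sum>i. if U i \<inter> J j \<noteq> {} then c i else 0) \<ge> 1" if "j < m" for j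
  proof (rule ccontr)
    assume less: "\<not> ?thesis"
    have "(if U i \<inter> J j \<noteq> {} then w i else 0) = \<tau> * (if U i \<inter> J j \<noteq> {} then c i else 0)" for i
    proof (cases "U i \<inter> J j \<noteq> {}")
      case True
      have "c i \<le> (\<Sum>i. if U i \<inter> J j \<noteq> {} then c i else 0)"
        using True by (intro le_suminf_hits sum_c c)
      with less have "c i < 1" by simp
      then show ?thesis using True \<tau> by (auto simp: c_def min_def split: if_splits)
    qed simp
    then have "hit_weight U w (J j) = \<tau> * (\<Sum>i. if U i \<inter> J j \<noteq> {} then c i else 0)"
      unfolding hit_weight_def
      by (simp only: suminf_mult[OF summable_hits[OF sum_c c(1)]])
    also have "\<dots> < \<tau>"
      using less \<tau> by simp
    finally show False using heavy[OF that] by simp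
  qed
  define W0 where "W0 = hit_weight U w {u..u+l}"
  have W0: "W0 \<ge> 0"
    unfolding W0_def hit_weight_def using w by (intro suminf_nonneg summable_hits) (auto intro: less_imp_le)
  have w0: "w i \<ge> 0" for i using w(1)[of i] by simp
  have "real m \<le> (\<Sum>j<m. (\<Sum>i. if U i \<inter> J j \<noteq> {} then c i else 0))"
    using sum_mono[of "{..<m}" "\<lambda>_. 1" "\<lambda>j. (\<Sum>i. if U i \<inter> J j \<noteq> {} then c i else 0)"] ge1 by simp
  also have "\<dots> = (\<Sum>i. \<Sum>j<m. if U i \<inter> J j \<noteq> {} then c i else 0)"
    by (intro suminf_sum[symmetric] summable_hits sum_c c)
  also have "\<dots> \<le> (\<Sum>i. (2 / \<tau> + W0 powr (1/s - 1) / h) * (if U i \<inter> {u..u+l} \<noteq> {} then w i else 0))"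
  proof (intro suminf_le summable_sum summable_hits sum_c c summable_mult w w0)
    fix i
    have eq: "(\<Sum>j<m. if U i \<inter> J j \<noteq> {} then c i else 0) = real (card {j. j < m \<and> U i \<inter> J j \<noteq> {}}) * c i"
      by (simp add: sum.If_cases Int_def)
    show "(\<Sum>j<m. if U i \<inter> J j \<noteq> {} then c i else 0)
        \<le> (2 / \<tau> + W0 powr (1/s - 1) / h) * (if U i \<inter> {u..u+l} \<noteq> {} then w i else 0)"
    proof (cases "U i \<inter> {u..u+l} = {}")
      case True
      then have "{j. j < m \<and> U i \<inter> J j \<noteq> {}} = {}"
        using J_sub by blast
      then show ?thesis using True unfolding eq by (simp only: card.empty) simp
    next
      case False
      have "w i \<le> W0"
        unfolding W0_def hit_weight_def using False by (intro le_suminf_hits w w0)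
      \<comment> \<open>Splitting the exponent makes the bound linear in \<open>w i\<close>, hence
        summable over \<open>i\<close>. The other factor is controlled because \<open>U i\<close>
        meets the parent interval, so \<open>w i \<le> W0\<close>, and \<open>1/s - 1\<close> is
        positive.\<close>
      have "diameter (U i) \<le> w i powr (1 + (1/s - 1))"
        using U by simp
      also have "\<dots> = w i * w i powr (1/s - 1)"
        using w(1)[of i] by (subst powr_add) simp
      also have "\<dots> \<le> w i * W0 powr (1/s - 1)"
        using \<open>w i \<le> W0\<close> w0 s by (intro mult_left_mono powr_mono2) auto
      finally have d: "diameter (U i) \<le> w i * W0 powr (1/s - 1)" .
      have "real (card {j. j < m \<and> U i \<inter> J j \<noteq> {}}) \<le> 2 + diameter (U i) / h"
        unfolding J_def using v h U
        by (intro card_indices_hit_le[where u = u]) (auto simp: algebra_simps)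
      then have "real (card {j. j < m \<and> U i \<inter> J j \<noteq> {}}) * c i \<le> (2 + diameter (U i) / h) * c i"
        using c by (intro mult_right_mono) auto
      also have "\<dots> = 2 * c i + (diameter (U i) / h) * c i"
        by (simp add: algebra_simps)
      also have "\<dots> \<le> 2 * (w i / \<tau>) + (diameter (U i) / h) * 1"
        using c[of i] h diameter_ge_0[OF U(1)[of i]] by (intro add_mono mult_left_mono) auto
      also have "\<dots> \<le> 2 * (w i / \<tau>) + (w i * W0 powr (1/s - 1) / h)"
        using d h by (simp add: divide_right_mono)
      finally show ?thesis using False unfolding eq by (simp add: algebra_simps)
    qed
  qed
  also have "\<dots> = (2 / \<tau> + W0 powr (1/s - 1) / h) * W0"
    unfolding W0_def hit_weight_def by (intro suminf_mult summable_hits w w0)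
  also have "\<dots> = 2 * W0 / \<tau> + W0 powr (1/s) / h"
    using W0 s by (cases "W0 = 0") (auto simp: powr_diff algebra_simps)
  \<comment> \<open>Each of the two terms is at most \<open>(l / h) / 8\<close>, the first by
    \<open>small\<close> and the second by the choice of \<open>\<theta>\<close>. This contradicts
    \<open>real m \<ge> l / (2 * h)\<close>.\<close>
  also have "\<dots> < 2 * (\<theta> * l powr s) / \<tau> + (\<theta> * l powr s) powr (1/s) / h"
    using W W0 \<tau> h s unfolding W0_def[symmetric]
    by (intro add_strict_mono divide_strict_right_mono powr_less_mono2) auto
  also have "(\<theta> * l powr s) powr (1/s) = \<theta> powr (1/s) * l"
    using \<theta> l s by (simp add: powr_mult powr_powr)
  also have "2 * (\<theta> * l powr s) / \<tau> = 2 * l powr s / \<eta> powr s"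
    using \<theta> by (simp add: \<tau>_def)
  also have "\<dots> \<le> (l / h) / 8"
    using small \<eta> h by (simp add: field_simps)
  also have "\<theta> powr (1/s) * l / h \<le> (1/8) * l / h"
    using \<theta> l h by (intro divide_right_mono mult_right_mono) auto
  finally have "real m < (l / h) / 4" by simp
  with m' l h show False by (simp add: field_simps)
qed

text \<open>A cover below the bound would allow \<open>hit_weight_descent\<close> to be iterated,
  always passing to length \<open>N powr -\<beta>\<close> with \<open>N\<close> large. The resulting
  nested intervals shrink to a point of the limsup set outside the cover. The bound is the same for
  every \<open>\<delta>\<close>, since the descent copes with large sets in the cover.\<close>

lemma hausdorff_premeasure_limsup_ge:
  fixes G :: "nat \<Rightarrow> real set"
  assumes s: "0 < s" "s < 1" and \<alpha>: "\<alpha> > 0" and \<beta>: "\<beta> > 0" "\<beta> * s < \<alpha>"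
    and G: "\<And>N u. N \<ge> N0 \<Longrightarrow> \<exists>v\<ge>u. v + real N powr -\<beta> \<le> u + real N powr -\<alpha> \<and> {v..v + real N powr -\<beta>} \<subseteq> G N"
    and l0: "l0 > 0" and sub: "{u0..u0+l0} \<subseteq> I"
  shows "hausdorff_premeasure s \<delta> {x\<in>I. infinite {N. x \<in> G N}} \<ge> ennreal ((1/8) powr s * l0 powr s / 2)"
  unfolding hausdorff_premeasure_def
proof (rule INF_greatest, rule ccontr, goal_cases)
  case (1 U)
  \<comment> \<open>\<open>\<theta> powr (1/s)\<close> is exactly \<open>1/8\<close>, as the descent
    requires. \<open>\<kappa>\<close> is half of the weight allowed on the initial interval; the
    other half pays for the perturbation of the weights.\<close>
  define \<theta> :: real where "\<theta> = (1/8) powr s"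
  define \<kappa> where "\<kappa> = \<theta> * l0 powr s / 2"
  have \<theta>: "\<theta> > 0" "\<theta> powr (1/s) \<le> 1/8"
    using s by (auto simp: \<theta>_def powr_powr)
  have \<kappa>: "\<kappa> > 0" using \<theta> l0 by (simp add: \<kappa>_def)
  have cover: "{x\<in>I. infinite {N. x \<in> G N}} \<subseteq> (\<Union>i. U i)" and bd: "\<And>i. bounded (U i)"
    using 1(1) by auto
  define p where "p = (\<lambda>i. diameter (U i) powr s)"
  have p: "p i \<ge> 0" for i by (simp add: p_def)
  have "diam_power s (U i) = ennreal (p i)" for i
    using s by (simp add: diam_power_def p_def)
  with 1(2) have lt: "(\<Sum>i. ennreal (p i)) < ennreal \<kappa>"
    by (simp add: \<kappa>_def \<theta>_def not_le)
  then have nt: "(\<Sum>i. ennreal (p i)) \<noteq> top" by auto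
  have sum_p: "summable p" 
    by (rule summable_suminf_not_top[OF p nt])
  have "(\<Sum>i. ennreal (p i)) = ennreal (suminf p)"
    by (rule suminf_ennreal[OF p nt])
  with lt have lt': "suminf p < \<kappa>"
    using suminf_nonneg[OF sum_p p] by (simp add: ennreal_less_iff)
  \<comment> \<open>The perturbation makes all weights positive, so that every set of the cover, even a singleton,
    is eventually avoided.\<close>
  define w where "w = (\<lambda>i. p i + \<kappa> * (1/2)^Suc i)"
  have w: "w i > 0" for i
    using p[of i] \<kappa> by (simp add: w_def add_nonneg_pos)
  have geo: "(\<lambda>i. \<kappa> * (1/2)^Suc i) sums (\<kappa> * 1)"
    by (intro sums_mult power_half_series)
  have sum_w: "summable w"
    unfolding w_def by (intro summable_add sum_p sums_summable[OF geo])
  have "suminf w < 2 * \<kappa>"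
    unfolding w_def using suminf_add[OF sum_p sums_summable[OF geo]] sums_unique[OF geo] lt' by simp
  then have suminf_w: "suminf w < \<theta> * l0 powr s"
    by (simp add: \<kappa>_def)
  have diam: "diameter (U i) \<le> w i powr (1/s)" for i
  proof -
    have "diameter (U i) = p i powr (1/s)"
      using diameter_ge_0[OF bd[of i]] s by (simp add: p_def powr_powr)
    also have "\<dots> \<le> w i powr (1/s)"
      using p[of i] \<kappa> s by (intro powr_mono2) (auto simp: w_def)
    finally show ?thesis .
  qed
  define good where "good = (\<lambda>(u, l). l > 0 \<and> hit_weight U w {u..u+l} < \<theta> * l powr s)"
  \<comment> \<open>Pairs are left endpoint and length. Requiring \<open>N \<ge> k\<close> at stage
    \<open>k\<close> puts the limit point in infinitely many \<open>G N\<close> and also forces the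
    lengths to tend to 0.\<close>
  define Next where "Next = (\<lambda>k (u, l) (v, l'). \<exists>N::nat\<ge>k. N \<ge> 1 \<and> l' = real N powr - \<beta> \<and> u \<le> v \<and> v + l' \<le> u + l
      \<and> {v..v+l'} \<subseteq> G N)"
  have step: "\<exists>J'. good J' \<and> Next k J J'" if "good J" for k J
  proof -
    obtain u l where J: "J = (u, l)" by force
    have l: "l > 0" and W: "hit_weight U w {u..u+l} < \<theta> * l powr s"
      using that by (auto simp: good_def J)
    have "((\<lambda>N. real N powr - \<alpha>) \<longlongrightarrow> 0) sequentially"
      using \<alpha> by (intro tendsto_neg_powr filterlim_real_sequentially) auto
    then have ev1: "eventually (\<lambda>N. real N powr - \<alpha> < l / 2) sequentially"
      using l by (auto dest: order_tendstoD(2)[of _ _ _ "l/2"])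
    \<comment> \<open>Here \<open>\<beta> * s < \<alpha>\<close> enters:
      \<open>N powr -\<alpha>\<close> is eventually negligible against
      \<open>(N powr -\<beta>) powr s\<close>. The constant 16 is the product of the two 4s in the
      smallness condition of the descent.\<close>
    have "((\<lambda>N. real N powr - (\<alpha> - \<beta> * s)) \<longlongrightarrow> 0) sequentially"
      using \<beta> by (intro tendsto_neg_powr filterlim_real_sequentially) auto
    then have ev2: "eventually (\<lambda>N. real N powr - (\<alpha> - \<beta> * s) < l / (16 * l powr s)) sequentially"
      using l by (auto dest: order_tendstoD(2)[of _ _ _ "l / (16 * l powr s)"])
    have "eventually (\<lambda>N. N \<ge> max (max k N0) 1) sequentially"
      by (rule eventually_ge_at_top)
    from eventually_happens[OF eventually_conj[OF ev1 eventually_conj[OF ev2 this]]]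
    obtain N where N: "real N powr - \<alpha> < l / 2" "real N powr - (\<alpha> - \<beta> * s) < l / (16 * l powr s)"
        "N \<ge> k" "N \<ge> N0" "N \<ge> 1"
      by auto
    have "real N powr - \<alpha> = real N powr - (\<alpha> - \<beta> * s) * (real N powr - \<beta>) powr s"
      by (simp add: powr_powr powr_add[symmetric])
    also have "\<dots> \<le> l / (16 * l powr s) * (real N powr - \<beta>) powr s"
      using N by (intro mult_right_mono) auto
    finally have "4 * l powr s * real N powr - \<alpha> \<le> l * (real N powr - \<beta>) powr s / 4"
      using l by (simp add: field_simps)
    from hit_weight_descent[OF bd diam w sum_w s _ _ _ W \<theta>(2,1) this G[OF N(4)]]
    obtain v where "v \<ge> u" "v + real N powr - \<beta> \<le> u + l" "{v..v + real N powr - \<beta>} \<subseteq> G N"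
        "hit_weight U w {v..v + real N powr - \<beta>} < \<theta> * (real N powr - \<beta>) powr s"
      using N by auto
    with N show ?thesis
      by (intro exI[of _ "(v, real N powr - \<beta>)"]) (auto simp: good_def Next_def J)
  qed
  have "hit_weight U w {u0..u0+l0} \<le> suminf w"
    unfolding hit_weight_def using w
    by (intro suminf_le summable_hits sum_w) (auto intro: less_imp_le)
  then have "good (u0, l0)"
    using suminf_w l0 by (simp add: good_def)
  \<comment> \<open>The clause for \<open>k = 0\<close> in the choice predicate pins the sequence to
    the initial interval.\<close>
  then obtain Q where Q: "Q 0 = (u0, l0)" "\<And>k. good (Q k)" "\<And>k. Next k (Q k) (Q (Suc k))"
    using dependent_nat_choice[of "\<lambda>k J. good J \<and> (k = 0 \<longrightarrow> J = (u0, l0))" "\<lambda>k J J'. Next k J J'"] step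
    by (metis Zero_neq_Suc)
  define u l where "u = (\<lambda>k. fst (Q k))" and "l = (\<lambda>k. snd (Q k))"
  define K where "K = (\<lambda>k. {u k..u k + l k})"
  have lpos: "l k > 0" and W: "hit_weight U w (K k) < \<theta> * l k powr s" for k
    using Q(2)[of k] by (auto simp: good_def u_def l_def K_def split: prod.splits)
  have nxt: "\<exists>N\<ge>k. N \<ge> 1 \<and> l (Suc k) = real N powr - \<beta> \<and> u k \<le> u (Suc k) \<and> u (Suc k) + l (Suc k) \<le> u k + l k \<and> K (Suc k) \<subseteq> G N" for k
    using Q(3)[of k] by (auto simp: Next_def u_def l_def K_def split: prod.splits)
  have dec: "K (Suc k) \<subseteq> K k" for k
    using nxt[of k] by (auto simp: K_def)
  have "\<Inter>(range K) \<noteq> {}"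
  proof (rule compact_nest)
    show "compact (K n)" "K n \<noteq> {}" for n
      using lpos[of n] by (auto simp: K_def)
    show "K n \<subseteq> K m" if "m \<le> n" for m n
      using that dec by (rule lift_Suc_antimono_le[rotated])
  qed
  then obtain x where x: "\<And>k. x \<in> K k" by auto
  have "infinite {N. x \<in> G N}"
    unfolding infinite_nat_iff_unbounded_le using nxt x by blast
  moreover have "x \<in> I"
    using x[of 0] sub by (auto simp: K_def u_def l_def Q(1))
  ultimately obtain i where i: "x \<in> U i"
    using cover by blast
  \<comment> \<open>The set \<open>U i\<close> containing \<open>x\<close> meets every
    \<open>K k\<close>, so its fixed positive weight lies below bounds that tend to 0.\<close>
  have w_le: "w i < \<theta> * l k powr s" for k
  proof -
    have "w i \<le> hit_weight U w (K k)"
      unfolding hit_weight_def using i x[of k] less_imp_le[OF w]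
      by (intro le_suminf_hits sum_w) auto
    with W[of k] show ?thesis by simp
  qed
  have "((\<lambda>k. \<theta> * real k powr - (\<beta> * s)) \<longlongrightarrow> \<theta> * 0) sequentially"
    using \<beta> s by (intro tendsto_mult tendsto_const tendsto_neg_powr filterlim_real_sequentially) auto
  then have "eventually (\<lambda>k. \<theta> * real k powr - (\<beta> * s) < w i) sequentially"
    using w[of i] by (auto dest: order_tendstoD(2))
  then obtain k where k: "k \<ge> 1" "\<theta> * real k powr - (\<beta> * s) < w i"
    using eventually_happens[OF eventually_conj[OF _ eventually_ge_at_top[of "1::nat"]]] by fastforce
  obtain N where N: "N \<ge> k" "l (Suc k) = real N powr - \<beta>"
    using nxt[of k] by blast
  have "l (Suc k) powr s = real N powr - (\<beta> * s)"
    by (simp add: N powr_powr)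
  also have "\<dots> \<le> real k powr - (\<beta> * s)"
    using N k \<beta> s by (intro powr_mono2') auto
  finally have "\<theta> * l (Suc k) powr s \<le> \<theta> * real k powr - (\<beta> * s)"
    using \<theta> by (intro mult_left_mono) auto
  with k w_le[of "Suc k"] show False by simp
qed

section \<open>Lower bounds for the Hausdorff dimension\<close>

lemma hausdorff_measure_0_imp_empty:
  assumes "hausdorff_measure 0 A = 0"
  shows "A = {}"
proof -
  have "hausdorff_premeasure 0 1 A \<le> hausdorff_measure 0 A"
    unfolding hausdorff_measure_def by (intro SUP_upper) auto
  with assms have "hausdorff_premeasure 0 1 A < 1" by simp
  then obtain U :: "nat \<Rightarrow> _" where U: "A \<subseteq> (\<Union>i. U i)" "(\<Sum>i. diam_power 0 (U i)) < 1"
    unfolding hausdorff_premeasure_def INF_less_iff by auto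
  \<comment> \<open>By the convention for exponent 0 a nonempty set contributes 1, which already
    exceeds the total.\<close>
  have "U i = {}" for i
    using ennreal_suminf_lessD[OF U(2), of i] by (auto simp: diam_power_def split: if_splits)
  with U show ?thesis by auto
qed

lemma hausdorff_measure_empty: "s > 0 \<Longrightarrow> hausdorff_measure s {} = 0"
  unfolding hausdorff_measure_def hausdorff_premeasure_def
  by (intro SUP_eq_const[THEN trans] antisym INF_lower2[of "\<lambda>_. {}"]) (auto simp: diam_power_def intro: exI[of _ 1])

text \<open>The infimum also ranges over \<open>s = 0\<close>, where the assumption is silent.
  Vanishing there makes \<open>A\<close> empty, and then the measure vanishes at \<open>d/2\<close>
  as well.\<close>

lemma hausdorff_dim_ge:
  assumes "\<And>s. 0 < s \<Longrightarrow> s < d \<Longrightarrow> hausdorff_measure s A \<noteq> 0"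
  shows "hausdorff_dim A \<ge> ennreal d"
  unfolding hausdorff_dim_def
proof (rule Inf_greatest, clarify)
  fix s assume s: "0 \<le> s" "hausdorff_measure s A = 0"
  show "ennreal d \<le> ennreal s"
  proof (rule ccontr)
    assume "\<not> ?thesis"
    then have "s < d" by (meson ennreal_leI not_le)
    with assms[of s] s have "s = 0" by force
    with s have "A = {}" using hausdorff_measure_0_imp_empty by auto
    with assms[of "d/2"] \<open>s < d\<close> \<open>s = 0\<close> show False
      by (simp add: hausdorff_measure_empty)
  qed
qed

subsection \<open>Intervals on which the sum is large\<close>

text \<open>
  Some piece of length about \<open>\<eta>\<close> inherits the hypothesis \<open>int\<close>. On it the mean square of \<open>D'\<close> is at
  most \<open>1 / K\<close> times the square of \<open>A = max (norm D)\<close>, so \<open>D\<close> oscillates by at most \<open>A / 2\<close>.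
\<close>
lemma large_on_subinterval:
  fixes D D' :: "real \<Rightarrow> complex"
  assumes D: "\<And>x. (D has_vector_derivative D' x) (at x)" and D': "continuous_on UNIV D'"
    and h: "0 < \<eta>" "\<eta> \<le> h" and K: "4 * \<eta> \<le> sqrt K" and M: "M > 0"
    and int: "h * M \<le> integral {u..u+h} (\<lambda>x. (norm (D x))\<^sup>2) - K * integral {u..u+h} (\<lambda>x. (norm (D' x))\<^sup>2)"
  shows "\<exists>v\<ge>u. v + \<eta> \<le> u + h \<and> (\<forall>x\<in>{v..v+\<eta>}. norm (D x) \<ge> sqrt M / 2)"
proof -
  have "sqrt K > 0" using K h by linarith
  then have "K > 0" by simp
  have contD: "continuous_on S D" for S
    by (rule continuous_on_vector_derivative) (rule has_vector_derivative_at_within[OF D])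
  have contD': "continuous_on S D'" for S
    by (rule continuous_on_subset[OF D']) simp
  define g where "g = (\<lambda>x. (norm (D x))\<^sup>2 - K * (norm (D' x))\<^sup>2 - M)"
  have g_int: "g integrable_on {x..y}" for x y
    unfolding g_def by (intro integrable_continuous_real continuous_intros contD contD')
  \<comment> \<open>Cutting into \<open>p\<close> equal pieces gives length \<open>q\<close> between
    \<open>\<eta>\<close> and \<open>2 * \<eta>\<close>. As the integral of \<open>g\<close> over
    the whole interval is nonnegative, so is that over some piece.\<close>
  define p where "p = nat \<lfloor>h / \<eta>\<rfloor>"
  define q where "q = h / real p"
  have "h / \<eta> \<ge> 1" using h by simp
  then have p': "real p \<le> h / \<eta>" "h / \<eta> < real p + 1"
    unfolding p_def by linarith+
  then have "real p > 0" using \<open>h / \<eta> \<ge> 1\<close> by linarith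
  then have p: "real p \<le> h / \<eta>" "real p \<ge> h / \<eta> / 2" "real p > 0"
    using p' by auto
  have q: "\<eta> \<le> q" "q \<le> 2 * \<eta>" "q > 0" "real p * q = h"
    using p h by (simp_all add: q_def field_simps)
  define F where "F = (\<lambda>x. integral {u..x} g)"
  have "(\<Sum>j<p. F (u + real (Suc j) * q) - F (u + real j * q)) = F (u + h) - F u"
    using q by (subst sum_lessThan_telescope) simp
  also have "\<dots> \<ge> 0"
  proof -
    have "F (u + h) = integral {u..u+h} (\<lambda>x. (norm (D x))\<^sup>2) - K * integral {u..u+h} (\<lambda>x. (norm (D' x))\<^sup>2) - h * M"
      unfolding F_def g_def using h
      by (subst integral_diff; (subst integral_diff)?)
         (auto intro!: integrable_continuous_real continuous_intros contD contD')
    then show ?thesis using int by (simp add: F_def)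
  qed
  finally have "\<not> (\<Sum>j<p. F (u + real (Suc j) * q) - F (u + real j * q)) < (\<Sum>j<p. 0)"
    by simp
  then obtain j where j: "j < p" "F (u + real (Suc j) * q) - F (u + real j * q) \<ge> 0"
    using sum_strict_mono[of "{..<p}" "\<lambda>j. F (u + real (Suc j) * q) - F (u + real j * q)" "\<lambda>_. 0"]
      p by (fastforce simp: not_le)
  define y where "y = u + real j * q"
  have "y \<ge> u" using q by (simp add: y_def)
  have "real (Suc j) * q \<le> real p * q"
    using j q by (intro mult_right_mono) auto
  then have yq: "u + real (Suc j) * q = y + q" "y + q \<le> u + h"
    using q by (auto simp: y_def algebra_simps)
  have "integral {y..y+q} g \<ge> 0"
    using j(2) Henstock_Kurzweil_Integration.integral_combine[where f = g and a = u and c = y and b = "y + q"] g_int \<open>y \<ge> u\<close> q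
    unfolding F_def yq y_def[symmetric] by simp
  moreover have "integral {y..y+q} g = integral {y..y+q} (\<lambda>x. (norm (D x))\<^sup>2) - K * integral {y..y+q} (\<lambda>x. (norm (D' x))\<^sup>2) - q * M"
    unfolding g_def using q
    by (subst integral_diff; (subst integral_diff)?)
       (auto intro!: integrable_continuous_real continuous_intros contD contD')
  ultimately have int': "q * M + K * integral {y..y+q} (\<lambda>x. (norm (D' x))\<^sup>2) \<le> integral {y..y+q} (\<lambda>x. (norm (D x))\<^sup>2)"
    by simp
  obtain x0 where x0: "x0 \<in> {y..y+q}" "\<And>x. x \<in> {y..y+q} \<Longrightarrow> norm (D x) \<le> norm (D x0)"
    using continuous_attains_sup[OF compact_Icc _ continuous_on_norm[OF contD], of y "y + q"] q
    by fastforce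
  define A where "A = norm (D x0)"
  define E where "E = integral {y..y+q} (\<lambda>x. (norm (D' x))\<^sup>2)"
  have "E \<ge> 0" unfolding E_def
    by (intro integral_nonneg integrable_continuous_real continuous_intros contD') auto
  have "integral {y..y+q} (\<lambda>x. (norm (D x))\<^sup>2) \<le> integral {y..y+q} (\<lambda>x. A\<^sup>2)"
    using x0 by (intro integral_le integrable_continuous_real continuous_intros contD power_mono)
      (auto simp: A_def)
  then have upper: "q * M + K * E \<le> q * A\<^sup>2"
    using int' q by (simp add: E_def)
  then have "q * M \<le> q * A\<^sup>2"
    using \<open>K > 0\<close> \<open>E \<ge> 0\<close> by (smt (verit) mult_nonneg_nonneg)
  then have "M \<le> A\<^sup>2" using q by simp
  then have "sqrt M \<le> A"
    by (intro real_le_lsqrt) (auto simp: A_def)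
  moreover have "sqrt M > 0" using M by simp
  ultimately have A: "sqrt M \<le> A" "A > 0" by linarith+
  have "K * E \<le> q * A\<^sup>2" using upper q M by (smt (verit) mult_pos_pos)
  then have E: "E \<le> q * A\<^sup>2 / K" using \<open>K > 0\<close> by (simp add: field_simps)
  \<comment> \<open>The value of \<open>t\<close> balances the two terms of
    \<open>norm (D' x) \<le> (t + (norm (D' x))\<^sup>2 / t) / 2\<close> after integration: each is
    at most \<open>q * t\<close>. This replaces Cauchy-Schwarz, and
    \<open>q \<le> 2 * \<eta> \<le> sqrt K / 2\<close> then gives \<open>A / 2\<close>.\<close>
  define t where "t = A / sqrt K"
  have t: "t > 0" using A \<open>K > 0\<close> by (simp add: t_def)
  have bound: "norm (D b - D a) \<le> A / 2" if "a \<le> b" "{a..b} \<subseteq> {y..y+q}" for a b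
  proof -
    have "(D' has_integral D b - D a) {a..b}"
      using that(1) has_vector_derivative_at_within[OF D] by (rule fundamental_theorem_of_calculus)
    then have "norm (D b - D a) = norm (integral {a..b} D')"
      by (simp add: integral_unique)
    also have "\<dots> \<le> integral {a..b} (\<lambda>x. (t + (norm (D' x))\<^sup>2 / t) / 2)"
    proof (rule integral_norm_bound_integral)
      fix x
      have "2 * (t * norm (D' x)) \<le> t\<^sup>2 + (norm (D' x))\<^sup>2"
        using sum_squares_bound[of t "norm (D' x)"] by (simp add: mult_ac)
      then show "norm (D' x) \<le> (t + (norm (D' x))\<^sup>2 / t) / 2"
        using t by (simp add: field_simps power2_eq_square)
    qed (use t in \<open>auto intro!: integrable_continuous_real continuous_intros contD'\<close>)
    also have "\<dots> \<le> integral {y..y+q} (\<lambda>x. (t + (norm (D' x))\<^sup>2 / t) / 2)"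
      using that t by (intro integral_subset_le) (auto intro!: integrable_continuous_real continuous_intros contD')
    also have "\<dots> = (q * t + E / t) / 2"
      unfolding E_def using t q
      by (simp add: integral_divide, subst integral_add)
         (auto intro!: integrable_continuous_real continuous_intros contD' simp: integral_divide)
    also have "\<dots> \<le> (q * t + (q * A\<^sup>2 / K) / t) / 2"
      using E t by (intro divide_right_mono add_left_mono) auto
    also have "(q * A\<^sup>2 / K) / t = q * t"
      using A \<open>K > 0\<close> by (simp add: t_def field_simps power2_eq_square)
    also have "(q * t + q * t) / 2 = q * (A / sqrt K)" by (simp add: t_def)
    also have "\<dots> \<le> (sqrt K / 2) * (A / sqrt K)"
      using q K A \<open>K > 0\<close> by (intro mult_right_mono) auto
    also have "\<dots> = A / 2" using \<open>K > 0\<close> by simp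
    finally show ?thesis .
  qed
  have "norm (D x) \<ge> sqrt M / 2" if "x \<in> {y..y+\<eta>}" for x
  proof -
    have "norm (D x - D x0) \<le> A / 2"
    proof (cases "x \<le> x0")
      case True
      then show ?thesis using bound[of x x0] x0 that by (auto simp: norm_minus_commute)
    next
      case False
      then show ?thesis using bound[of x0 x] x0 that q by auto
    qed
    moreover have "A \<le> norm (D x) + norm (D x - D x0)"
      unfolding A_def by (metis norm_minus_commute norm_triangle_sub)
    ultimately show ?thesis using A by simp
  qed
  then show ?thesis using \<open>y \<ge> u\<close> yq(2) q by (intro exI[of _ y]) auto
qed

text \<open>Dividing out \<open>e (x * f (real N))\<close> keeps the norm and replaces the
  frequencies by \<open>f n - f N\<close>, which lie in \<open>[0, \<Lambda>]\<close>. The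
  derivative is then governed by the spread of the frequencies, not their size, and the mean squares
  of \<open>D\<close> and \<open>D'\<close> can be compared.\<close>

lemma large_exponential_sum_subinterval:
  fixes a :: "nat \<Rightarrow> complex" and f :: "real \<Rightarrow> real" and N :: nat
  assumes N: "N \<ge> 1" and a: "\<And>n. n \<ge> 1 \<Longrightarrow> norm (a n) = 1"
    and gap: "\<And>m n. N \<le> m \<Longrightarrow> m \<le> n \<Longrightarrow> n \<le> 2 * N \<Longrightarrow> f (real n) - f (real m) \<ge> \<delta> * (real n - real m)"
    and size: "\<And>n. N \<le> n \<Longrightarrow> n \<le> 2 * N \<Longrightarrow> f (real n) - f (real N) \<le> \<Lambda>"
    and pos: "\<delta> > 0" "0 < \<eta>" "\<eta> \<le> h" "\<Lambda> > 0"
    and h: "4 * harm N \<le> \<delta> * h" and \<eta>: "24 * pi * \<Lambda> * \<eta> \<le> 1"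
  shows "\<exists>v\<ge>u. v + \<eta> \<le> u + h \<and>
    (\<forall>x\<in>{v..v+\<eta>}. norm (\<Sum>n\<in>{N<..2*N}. a n * e (x * f (real n))) \<ge> sqrt N / 4)"
proof -
  define \<nu> where "\<nu> = (\<lambda>n::nat. f (real n) - f (real N))"
  define A where "A = {N<..N+N}"
  define B where "B = 2 * pi * \<Lambda>"
  define D where "D = (\<lambda>x. \<Sum>n\<in>A. a n * e (x * \<nu> n))"
  define b where "b = (\<lambda>n. a n * ((2 * pi * \<nu> n) * \<i>))"
  define D' where "D' = (\<lambda>x. \<Sum>n\<in>A. b n * e (x * \<nu> n))"
  have B: "B > 0" using pos by (simp add: B_def)
  have h0: "h > 0" using pos by simp
  have sep: "\<bar>\<nu> m - \<nu> n\<bar> \<ge> \<delta> * \<bar>real m - real n\<bar>" if "m \<in> A" "n \<in> A" for m n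
  proof (cases "m \<le> n")
    case True
    then show ?thesis using gap[of m n] that by (auto simp: A_def \<nu>_def)
  next
    case False
    then show ?thesis using gap[of n m] that by (auto simp: A_def \<nu>_def)
  qed
  have \<nu>: "\<bar>\<nu> n\<bar> \<le> \<Lambda>" if "n \<in> A" for n
  proof -
    have "0 \<le> \<delta> * (real n - real N)" using that pos by (auto simp: A_def)
    also have "\<dots> \<le> \<nu> n"
      using gap[of N n] that by (auto simp: A_def \<nu>_def)
    finally show ?thesis using size[of n] that by (auto simp: A_def \<nu>_def)
  qed
  have a1: "norm (a n) = 1" if "n \<in> A" for n
    using a that by (auto simp: A_def)
  have b: "norm (b n) \<le> B" if "n \<in> A" for n
    using \<nu>[OF that] a1[OF that] by (simp add: b_def B_def norm_mult)
  have deriv: "(D has_vector_derivative D' x) (at x)" for x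
    unfolding D_def D'_def b_def mult.assoc[of "a _"]
    by (intro has_vector_derivative_sum has_vector_derivative_mult_right has_vector_derivative_e)
  have cont: "continuous_on UNIV D'"
    unfolding D'_def by (intro continuous_intros)
  \<comment> \<open>The condition on \<open>h\<close> makes the off-diagonal error at most half of
    the diagonal term \<open>h * N\<close>.\<close>
  have offdiag: "2 * real N * harm N / \<delta> \<le> h * N / 2"
    using h pos mult_left_mono[OF h, of "real N"] by (simp add: field_simps)
  have "\<bar>integral {u..u+h} (\<lambda>x. (norm (D x))\<^sup>2) - h * N\<bar> \<le> 2 * real N * harm N / \<delta>"
    using mean_square_exponential_sum[of N N \<delta> \<nu> a 1 h u] sep a1 pos h0
    unfolding D_def A_def by simp
  then have lower: "integral {u..u+h} (\<lambda>x. (norm (D x))\<^sup>2) \<ge> h * N / 2"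
    using offdiag by linarith
  have "\<bar>integral {u..u+h} (\<lambda>x. (norm (D' x))\<^sup>2) - h * (\<Sum>n\<in>A. (norm (b n))\<^sup>2)\<bar>
      \<le> B\<^sup>2 * (2 * real N * harm N / \<delta>)"
    using mean_square_exponential_sum[of N N \<delta> \<nu> b B h u] sep b pos h0
    unfolding D'_def A_def by simp
  also have "\<dots> \<le> B\<^sup>2 * (h * N / 2)"
    by (intro mult_left_mono offdiag) auto
  also have "\<dots> \<le> B\<^sup>2 * (h * N)"
    using h0 by (intro mult_left_mono) auto
  finally have "integral {u..u+h} (\<lambda>x. (norm (D' x))\<^sup>2) \<le> h * (\<Sum>n\<in>A. (norm (b n))\<^sup>2) + B\<^sup>2 * (h * N)"
    by linarith
  moreover have "(\<Sum>n\<in>A. (norm (b n))\<^sup>2) \<le> N * B\<^sup>2"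
    using sum_bounded_above[of A "\<lambda>n. (norm (b n))\<^sup>2" "B\<^sup>2"] b by (simp add: A_def power_mono)
  then have "h * (\<Sum>n\<in>A. (norm (b n))\<^sup>2) \<le> h * (N * B\<^sup>2)"
    using h0 by (intro mult_left_mono) auto
  ultimately have upper: "integral {u..u+h} (\<lambda>x. (norm (D' x))\<^sup>2) \<le> 2 * B\<^sup>2 * (h * N)"
    by (simp add: algebra_simps)
  \<comment> \<open>With this \<open>K\<close> the derivative uses up \<open>h * N / 4\<close> of
    the available \<open>h * N / 2\<close>, which leaves \<open>M = N / 4\<close>.\<close>
  define K where "K = 1 / (8 * B\<^sup>2)"
  have "K * integral {u..u+h} (\<lambda>x. (norm (D' x))\<^sup>2) \<le> K * (2 * B\<^sup>2 * (h * N))"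
    using upper by (intro mult_left_mono) (auto simp: K_def)
  also have "\<dots> = h * N / 4" using B by (simp add: K_def)
  finally have int: "h * (N / 4) \<le> integral {u..u+h} (\<lambda>x. (norm (D x))\<^sup>2) - K * integral {u..u+h} (\<lambda>x. (norm (D' x))\<^sup>2)"
    using lower by simp
  have "12 * B * \<eta> \<le> 1" using \<eta> by (simp add: B_def mult_ac)
  \<comment> \<open>The 24 in the condition on \<open>\<eta>\<close> comes from here:
    \<open>sqrt K\<close> is \<open>1 / (sqrt 8 * B)\<close>, and 3 exceeds
    \<open>sqrt 8\<close>.\<close>
  then have "4 * \<eta> \<le> 1 / (3 * B)" using B by (simp add: field_simps)
  also have "\<dots> \<le> sqrt K"
    using B by (intro real_le_rsqrt) (simp add: K_def power_divide power_mult_distrib frac_le)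
  finally have K: "4 * \<eta> \<le> sqrt K" .
  have eq: "norm (\<Sum>n\<in>{N<..2*N}. a n * e (x * f (real n))) = norm (D x)" for x
  proof -
    have "(\<Sum>n\<in>{N<..2*N}. a n * e (x * f (real n))) = (\<Sum>n\<in>A. e (x * f (real N)) * (a n * e (x * \<nu> n)))"
    proof (intro sum.cong)
      fix n
      have "x * f (real n) = x * f (real N) + x * \<nu> n" by (simp add: \<nu>_def algebra_simps)
      then show "a n * e (x * f (real n)) = e (x * f (real N)) * (a n * e (x * \<nu> n))"
        by (simp add: e_add)
    qed (auto simp: A_def)
    also have "\<dots> = e (x * f (real N)) * D x" by (simp add: D_def sum_distrib_left)
    finally show ?thesis by (simp add: norm_mult)
  qed
  have "sqrt (real N / 4) / 2 = sqrt N / 4" by (simp add: real_sqrt_divide)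
  moreover have "real N / 4 > 0" using N by simp
  note large_on_subinterval[OF deriv cont pos(2,3) K this int]
  ultimately show ?thesis by (simp only: eq)
qed

text \<open>The mean value theorem on \<open>[N, 2 * N]\<close> gives gaps \<open>\<delta>\<close>
  of order \<open>N powr (\<gamma> - 1 - \<epsilon>)\<close> and spread \<open>\<Lambda>\<close> of
  order \<open>N powr (\<gamma> + \<epsilon>)\<close>. Using \<open>2 * \<epsilon>\<close> in the
  exponents of \<open>h\<close> and \<open>\<eta>\<close> leaves a factor
  \<open>N powr \<epsilon>\<close> to absorb the harmonic number and the constants.\<close>

lemma large_exponential_sum_near_every_point:
  fixes \<gamma> \<epsilon> :: real and f :: "real \<Rightarrow> real" and a :: "nat \<Rightarrow> complex"
  assumes f: "f C1_differentiable_on {0<..}" and a: "\<And>n. n \<ge> 1 \<Longrightarrow> norm (a n) = 1"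
    and \<epsilon>: "0 < \<epsilon>" "\<epsilon> < \<gamma> - 1"
    and f': "eventually (\<lambda>t. t powr (\<gamma> - 1 - \<epsilon>) \<le> deriv f t \<and> deriv f t \<le> t powr (\<gamma> - 1 + \<epsilon>)) at_top"
  shows "\<exists>N0. \<forall>N\<ge>N0. \<forall>u.
    \<exists>v\<ge>u. v + real N powr -(\<gamma> + 2*\<epsilon>) \<le> u + real N powr -(\<gamma> - 1 - 2*\<epsilon>) \<and>
      (\<forall>x\<in>{v..v + real N powr -(\<gamma> + 2*\<epsilon>)}. norm (\<Sum>n\<in>{N<..2*N}. a n * e (x * f (real n))) \<ge> sqrt N / 4)"
proof -
  obtain T where T: "\<And>t. t \<ge> T \<Longrightarrow> t powr (\<gamma> - 1 - \<epsilon>) \<le> deriv f t \<and> deriv f t \<le> t powr (\<gamma> - 1 + \<epsilon>)"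
    using f' by (auto simp: eventually_at_top_linorder)
  have df: "(f has_real_derivative deriv f t) (at t)" if "t > 0" for t
  proof -
    obtain D where "(f has_vector_derivative D) (at t)"
      using f \<open>t > 0\<close> by (auto simp: C1_differentiable_on_def)
    then have "(f has_real_derivative D) (at t)"
      by (simp add: has_real_derivative_iff_has_vector_derivative)
    then show ?thesis using DERIV_imp_deriv by blast
  qed
  \<comment> \<open>The first entry serves \<open>4 * harm N\<close>, through
    \<open>ln N \<le> N powr (\<epsilon> / 2) / (\<epsilon> / 2)\<close>; the second is the constant
    in \<open>24 * pi * \<Lambda> * \<eta>\<close>.\<close>
  define C where "C = max (8 / \<epsilon> + 4) (24 * pi * 2 powr (\<gamma> - 1 + \<epsilon>))"
  have "C > 0" using \<epsilon> by (simp add: C_def less_max_iff_disj)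
  have "((\<lambda>N. real N powr -(\<epsilon> / 2)) \<longlongrightarrow> 0) sequentially"
    using \<epsilon> by (intro tendsto_neg_powr filterlim_real_sequentially) auto
  then have "eventually (\<lambda>N. real N powr -(\<epsilon> / 2) < 1 / C) sequentially"
    using \<open>C > 0\<close> by (auto dest: order_tendstoD(2)[of _ _ _ "1 / C"])
  moreover have "eventually (\<lambda>N. real N \<ge> T \<and> N \<ge> 1) sequentially"
    using filterlim_real_sequentially by (intro eventually_conj eventually_ge_at_top) (auto simp: filterlim_at_top)
  ultimately have "eventually (\<lambda>N. real N powr (\<epsilon> / 2) \<ge> C \<and> real N \<ge> T \<and> N \<ge> 1) sequentially"
    by eventually_elim (use \<open>C > 0\<close> in \<open>auto simp: powr_minus field_simps\<close>)
  then obtain N0 where N0: "\<And>N. N \<ge> N0 \<Longrightarrow> real N powr (\<epsilon> / 2) \<ge> C \<and> real N \<ge> T \<and> N \<ge> 1"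
    by (auto simp: eventually_sequentially)
  show ?thesis
  proof (rule exI[of _ N0], intro allI impI)
    fix N u assume "N \<ge> N0"
    then have N: "real N powr (\<epsilon> / 2) \<ge> C" "real N \<ge> T" "real N \<ge> 1" "N \<ge> 1"
      using N0[of N] by auto
    define \<delta> where "\<delta> = real N powr (\<gamma> - 1 - \<epsilon>)"
    define \<Lambda> where "\<Lambda> = real N * (2 * real N) powr (\<gamma> - 1 + \<epsilon>)"
    define h where "h = real N powr -(\<gamma> - 1 - 2*\<epsilon>)"
    define \<eta> where "\<eta> = real N powr -(\<gamma> + 2*\<epsilon>)"
    have mvt: "\<delta> * (y - x) \<le> f y - f x \<and> f y - f x \<le> (2 * real N) powr (\<gamma> - 1 + \<epsilon>) * (y - x)"
      if "real N \<le> x" "x \<le> y" "y \<le> 2 * real N" for x y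
    proof (cases "x = y")
      case False
      with that have "x < y" by simp
      moreover have "(f has_real_derivative deriv f t) (at t)" if "x \<le> t" for t
        using df[of t] that \<open>real N \<le> x\<close> N by linarith
      ultimately obtain z where z: "x < z" "z < y" "f y - f x = (y - x) * deriv f z"
        using MVT2[of x y f "deriv f"] by blast
      have "\<delta> \<le> z powr (\<gamma> - 1 - \<epsilon>)"
        unfolding \<delta>_def using z that \<epsilon> N by (intro powr_mono2) auto
      then have 1: "\<delta> \<le> deriv f z" using T[of z] z that N by auto
      have "z powr (\<gamma> - 1 + \<epsilon>) \<le> (2 * real N) powr (\<gamma> - 1 + \<epsilon>)"
        using z that \<epsilon> N by (intro powr_mono2) auto
      then have 2: "deriv f z \<le> (2 * real N) powr (\<gamma> - 1 + \<epsilon>)" using T[of z] z that N by auto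
      show ?thesis
        unfolding z(3) using mult_right_mono[OF 1, of "y - x"] mult_right_mono[OF 2, of "y - x"] that
        by (simp add: mult.commute)
    qed simp
    have pos: "\<delta> > 0" "0 < \<eta>" "\<eta> \<le> h" "\<Lambda> > 0"
      using N \<epsilon> by (auto simp: \<delta>_def \<eta>_def \<Lambda>_def h_def intro!: powr_mono)
    have N\<epsilon>: "1 \<le> real N powr (\<epsilon> / 2)" "real N powr \<epsilon> = real N powr (\<epsilon> / 2) * real N powr (\<epsilon> / 2)"
      using N \<epsilon> by (auto simp: powr_add[symmetric] ge_one_powr_ge_zero)
    have "4 * harm N \<le> 4 * (ln (real N) + 1)"
      using euler_mascheroni_sequence_decreasing[of 1 N] N by (simp add: harm_def)
    also have "\<dots> \<le> 4 * (real N powr (\<epsilon> / 2) / (\<epsilon> / 2) + real N powr (\<epsilon> / 2))"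
      using ln_powr_bound[of "real N" "\<epsilon> / 2"] N \<epsilon> N\<epsilon> by (intro mult_left_mono add_mono) auto
    also have "\<dots> = (8 / \<epsilon> + 4) * real N powr (\<epsilon> / 2)"
      by (simp add: algebra_simps)
    also have "\<dots> \<le> real N powr (\<epsilon> / 2) * real N powr (\<epsilon> / 2)"
      using N by (intro mult_right_mono) (auto simp: C_def)
    also have "\<dots> = \<delta> * h"
      by (simp add: \<delta>_def h_def powr_add[symmetric])
    finally have harm: "4 * harm N \<le> \<delta> * h" .
    have "24 * pi * 2 powr (\<gamma> - 1 + \<epsilon>) \<le> real N powr (\<epsilon> / 2) * 1"
      using N by (simp add: C_def)
    also have "\<dots> \<le> real N powr \<epsilon>"
      unfolding N\<epsilon>(2) using N\<epsilon> by (intro mult_left_mono) auto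
    finally have C: "24 * pi * 2 powr (\<gamma> - 1 + \<epsilon>) \<le> real N powr \<epsilon>" .
    have "\<Lambda> * \<eta> = 2 powr (\<gamma> - 1 + \<epsilon>) * (real N * real N powr (\<gamma> - 1 + \<epsilon>) * real N powr -(\<gamma> + 2*\<epsilon>))"
      using N by (simp add: \<Lambda>_def \<eta>_def powr_mult)
    also have "\<dots> = 2 powr (\<gamma> - 1 + \<epsilon>) * real N powr -\<epsilon>"
      by (simp add: powr_mult_base powr_add[symmetric])
    finally have "24 * pi * \<Lambda> * \<eta> = (24 * pi * 2 powr (\<gamma> - 1 + \<epsilon>)) / real N powr \<epsilon>"
      by (simp add: powr_minus divide_inverse mult.assoc)
    also have "\<dots> \<le> 1" using C N by (simp add: field_simps)
    finally have size: "24 * pi * \<Lambda> * \<eta> \<le> 1" .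
    show "\<exists>v\<ge>u. v + real N powr -(\<gamma> + 2*\<epsilon>) \<le> u + real N powr -(\<gamma> - 1 - 2*\<epsilon>) \<and>
      (\<forall>x\<in>{v..v + real N powr -(\<gamma> + 2*\<epsilon>)}. norm (\<Sum>n\<in>{N<..2*N}. a n * e (x * f (real n))) \<ge> sqrt N / 4)"
      unfolding \<eta>_def[symmetric] h_def[symmetric]
    proof (rule large_exponential_sum_subinterval[OF N(4) a _ _ pos harm size])
      show "\<delta> * (real n - real m) \<le> f (real n) - f (real m)" if "N \<le> m" "m \<le> n" "n \<le> 2 * N" for m n
        using mvt[of m n] that by auto
      show "f (real n) - f (real N) \<le> \<Lambda>" if "N \<le> n" "n \<le> 2 * N" for n
      proof -
        have "f (real n) - f (real N) \<le> (2 * real N) powr (\<gamma> - 1 + \<epsilon>) * (real n - real N)"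
          using mvt[of N n] that by auto
        also have "\<dots> \<le> (2 * real N) powr (\<gamma> - 1 + \<epsilon>) * real N"
          using that by (intro mult_left_mono) auto
        finally show ?thesis by (simp add: \<Lambda>_def mult.commute)
      qed
    qed auto
  qed
qed

section \<open>The dimension bound for the set of large partial sums\<close>

theorem theorem2p7:
  fixes \<gamma> :: real and f :: "real \<Rightarrow> real" and a :: "nat \<Rightarrow> complex"
  assumes "\<gamma> > 1"
    and "f C1_differentiable_on {0<..}"
    and "\<And>\<epsilon>. \<epsilon> > 0 \<Longrightarrow>
      eventually (\<lambda>t. t powr (\<gamma> - 1 - \<epsilon>) \<le> deriv f t \<and> deriv f t \<le> t powr (\<gamma> - 1 + \<epsilon>)) at_top"
    and "\<And>n. n \<ge> 1 \<Longrightarrow> norm (a n) = 1"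
  shows "\<exists>c>0. \<forall>I :: real set. is_interval I \<and> interior I \<noteq> {} \<longrightarrow>
    hausdorff_dim {x \<in> I. infinite {N :: nat. norm (\<Sum>n=1..N. a n * e (x * f (real n))) \<ge> c * real N powr (1/2)}}
      \<ge> ennreal (1 - 1 / \<gamma>)"
proof (intro exI[of _ "1/16"] conjI allI impI hausdorff_dim_ge; (elim conjE)?)
  fix I :: "real set" and s :: real
  assume I: "interior I \<noteq> {}" and s: "0 < s" "s < 1 - 1 / \<gamma>"
  define S where "S = (\<lambda>N x. \<Sum>n=1..N. a n * e (x * f (real n)))"
  define L where "L = {x \<in> I. infinite {N. norm (S N x) \<ge> 1/16 * real N powr (1/2)}}"
  define G where "G = (\<lambda>N. {x. norm (\<Sum>n\<in>{N<..2*N}. a n * e (x * f (real n))) \<ge> sqrt (real N) / 4})"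
  have "\<gamma> * s < \<gamma> - 1" using s assms(1) by (simp add: field_simps)
  moreover have "1 / \<gamma> > 0" using assms(1) by simp
  with s have "s < 1" by linarith
  \<comment> \<open>An eighth of the slack in \<open>\<gamma> * s < \<gamma> - 1\<close> suffices:
    passing to the exponents \<open>\<gamma> + 2 * \<epsilon>\<close> and
    \<open>\<gamma> - 1 - 2 * \<epsilon>\<close> costs
    \<open>2 * \<epsilon> * s + 2 * \<epsilon>\<close>, less than
    \<open>4 * \<epsilon>\<close>.\<close>
  define \<epsilon> where "\<epsilon> = (\<gamma> - 1 - \<gamma> * s) / 8"
  have "\<gamma> * s > 0" using s assms(1) by simp
  ultimately have \<epsilon>: "0 < \<epsilon>" "8 * \<epsilon> < \<gamma> - 1"
    by (auto simp: \<epsilon>_def)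
  have "\<epsilon> * s < \<epsilon>" using \<epsilon> \<open>s < 1\<close> by simp
  moreover have "8 * \<epsilon> = \<gamma> - 1 - \<gamma> * s" by (simp add: \<epsilon>_def)
  ultimately have dim: "(\<gamma> + 2 * \<epsilon>) * s < \<gamma> - 1 - 2 * \<epsilon>"
    using \<epsilon>(1) unfolding distrib_right by linarith
  have "\<epsilon> < \<gamma> - 1" using \<epsilon> by linarith
  from large_exponential_sum_near_every_point[of f a \<epsilon> \<gamma>, OF assms(2) _ \<epsilon>(1) this assms(3)[OF \<epsilon>(1)]] assms(4)
  obtain N0 where N0: "\<And>N u. N \<ge> N0 \<Longrightarrow>
    \<exists>v\<ge>u. v + real N powr -(\<gamma> + 2*\<epsilon>) \<le> u + real N powr -(\<gamma> - 1 - 2*\<epsilon>) \<and>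
      {v..v + real N powr -(\<gamma> + 2*\<epsilon>)} \<subseteq> G N"
    unfolding G_def subset_iff mem_Collect_eq Ball_def by blast
  obtain y r where y: "r > 0" "ball y r \<subseteq> I"
    using I by (auto simp: mem_interior)
  then have sub: "{y..y + r/2} \<subseteq> I"
    by (auto simp: dist_real_def subset_iff)
  define Z where "Z = {x \<in> I. infinite {N. x \<in> G N}}"
  have "Z \<subseteq> L"
  proof
    fix x assume x: "x \<in> Z"
    \<comment> \<open>One of \<open>N\<close> and \<open>2 * N\<close> serves as \<open>N'\<close>.
      With constant \<open>1/16\<close> and \<open>sqrt (2 * N) \<le> 2 * sqrt N\<close>, two small
      partial sums would bound the block by \<open>3/16 * sqrt N\<close>, below its size
      \<open>sqrt N / 4\<close>.\<close>
    have "\<exists>N'\<ge>N. norm (S N' x) \<ge> 1/16 * real N' powr (1/2)" if "x \<in> G N" for N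
    proof (rule ccontr)
      assume "\<not> ?thesis"
      then have "norm (S N' x) < 1/16 * sqrt N'" if "N' \<ge> N" for N'
        using that unfolding powr_half_sqrt[OF of_nat_0_le_iff] by (meson not_le)
      from this[of N] this[of "2 * N"]
      have "norm (S N x) < 1/16 * sqrt N" "norm (S (2 * N) x) < 1/16 * sqrt (2 * N)"
        by auto
      moreover have "sqrt (real (2 * N)) \<le> 2 * sqrt N"
        by (intro real_le_lsqrt) (auto simp: power_mult_distrib)
      moreover have "S (2 * N) x = S N x + (\<Sum>n\<in>{N<..2*N}. a n * e (x * f (real n)))"
      proof -
        have "{1..2*N} = {1..N} \<union> {N<..2*N}" by auto
        then show ?thesis unfolding S_def by (simp only:) (intro sum.union_disjoint; auto)
      qed
      then have "norm (\<Sum>n\<in>{N<..2*N}. a n * e (x * f (real n))) \<le> norm (S (2 * N) x) + norm (S N x)"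
        by (metis add_diff_cancel_left' norm_triangle_ineq4)
      moreover have "sqrt (real N) \<ge> 0" by simp
      ultimately show False using that unfolding G_def mem_Collect_eq by linarith
    qed
    then show "x \<in> L"
      using x unfolding Z_def L_def infinite_nat_iff_unbounded_le
      by (auto intro: order_trans) (meson order_trans)
  qed
  have L_eq: "{x \<in> I. infinite {N. norm (\<Sum>n=1..N. a n * e (x * f (real n))) \<ge> 1/16 * real N powr (1/2)}} = L"
    by (simp only: L_def S_def)
  show "hausdorff_measure s {x \<in> I. infinite {N. norm (\<Sum>n=1..N. a n * e (x * f (real n))) \<ge> 1/16 * real N powr (1/2)}} \<noteq> 0"
    unfolding L_eq
  proof
    assume "hausdorff_measure s L = 0"
    then have "hausdorff_premeasure s 1 L \<le> 0"
      unfolding hausdorff_measure_def by (metis SUP_upper greaterThan_iff zero_less_one)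
    moreover have "hausdorff_premeasure s 1 Z \<le> hausdorff_premeasure s 1 L"
      unfolding hausdorff_premeasure_def using \<open>Z \<subseteq> L\<close> by (intro INF_superset_mono) auto
    moreover have "ennreal ((1/8) powr s * (r/2) powr s / 2) \<le> hausdorff_premeasure s 1 Z"
      unfolding Z_def
      by (rule hausdorff_premeasure_limsup_ge[OF s(1) \<open>s < 1\<close> _ _ dim N0 _ sub])
         (use \<epsilon> \<open>\<gamma> > 1\<close> y in auto)
    ultimately have "ennreal ((1/8) powr s * (r/2) powr s / 2) \<le> 0" by order
    moreover have "(1/8) powr s * (r/2) powr s / 2 > 0" using y by simp
    ultimately show False by (simp only: ennreal_eq_0_iff le_zero_eq not_le)
  qed
qed simp

end
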